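(* Let $p$ be an odd prime and let $b_0,b_1,b_2,\ldots\in\mathbb{Q}_p$. Define $B_0=1$, $B_1=b_1$ and $B_n=b_nB_{n-1}+B_{n-2}$ for $n\geq 2$. Then the following are equivalent: (i) $v_p(b_{n+1}B_{n})<v_p(B_{n-1})$ for all $n\geq 1$; (ii) $v_p(b_nb_{n+1})<0$ for all $n\geq 1$.
   Context: $v_p$ denotes the $p$-adic valuation on $\mathbb{Q}_p$. The $B_n$ are the denominators of the convergents $A_n/B_n$ of the continued fraction $[b_0,b_1,b_2,\ldots]=b_0+\cfrac{1}{b_1+\cfrac{1}{b_2+\cdots}}$. *)

theory Defs
  imports
    "HOL-Computational_Algebra.Fraction_Field"
    "HOL-Library.Extended"
    "Berlekamp_Zassenhaus.Finite_Field"
begin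

text \<open>
  The prime \<open>p\<close> is carried by a type \<open>'p\<close> of class \<open>prime_card\<close>, namely \<open>p = CARD('p)\<close>.
  The ring of \<open>p\<close>-adic integers is the inverse limit of the rings \<open>\<int>/p\<^sup>n\<int>\<close>: its elements are
  the sequences whose \<open>n\<close>-th entry is the canonical representative of a residue class
  modulo \<open>p\<^sup>n\<close>, successive entries being compatible under reduction.
\<close>

typedef (overloaded) ('p::prime_card) padic_int =
  "{f :: nat \<Rightarrow> int. \<forall>n. f n \<in> {0..<int CARD('p) ^ n} \<and> f (Suc n) mod int CARD('p) ^ n = f n}"
  morphisms padic_residue Abs_padic_int
proof
  have "0 < int CARD('p)"
    using prime_card_int[where 'a='p] prime_gt_0_int by blast
  then show "(\<lambda>_. 0) \<in> {f :: nat \<Rightarrow> int.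
      \<forall>n. f n \<in> {0..<int CARD('p) ^ n} \<and> f (Suc n) mod int CARD('p) ^ n = f n}"
    by simp
qed

setup_lifting type_definition_padic_int

lemma CARD_prime_pos [simp]: "0 < int CARD('p::prime_card)"
  using prime_card_int[where 'a='p] prime_gt_0_int by blast

lemma mod_mod_power_Suc [simp]: "(a::int) mod (q ^ Suc n) mod q ^ n = a mod q ^ n"
  by (rule mod_mod_cancel) (simp add: le_imp_power_dvd)

lemma mod_mod_mult_power [simp]: "(a::int) mod (q * q ^ n) mod q ^ n = a mod q ^ n"
  by (rule mod_mod_cancel) simp

instantiation padic_int :: (prime_card) comm_ring_1
begin

lift_definition zero_padic_int :: "'a padic_int" is "\<lambda>_. 0"
  by simp

lift_definition one_padic_int :: "'a padic_int" is "\<lambda>n. 1 mod int CARD('a) ^ n"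
  by simp

lift_definition plus_padic_int :: "'a padic_int \<Rightarrow> 'a padic_int \<Rightarrow> 'a padic_int"
  is "\<lambda>f g n. (f n + g n) mod int CARD('a) ^ n"
  apply simp
  apply (metis mod_add_eq)
  done

lift_definition uminus_padic_int :: "'a padic_int \<Rightarrow> 'a padic_int"
  is "\<lambda>f n. (- f n) mod int CARD('a) ^ n"
  apply simp
  apply (metis mod_minus_eq)
  done

lift_definition minus_padic_int :: "'a padic_int \<Rightarrow> 'a padic_int \<Rightarrow> 'a padic_int"
  is "\<lambda>f g n. (f n - g n) mod int CARD('a) ^ n"
  apply simp
  apply (metis mod_diff_eq)
  done

lift_definition times_padic_int :: "'a padic_int \<Rightarrow> 'a padic_int \<Rightarrow> 'a padic_int"
  is "\<lambda>f g n. (f n * g n) mod int CARD('a) ^ n"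
  apply simp
  apply (metis mod_mult_eq)
  done

instance
proof
  fix a b c :: "'a padic_int"
  show "a * b * c = a * (b * c)"
    by transfer (simp add: mod_simps mult.assoc)
  show "a * b = b * a"
    by transfer (simp add: mult.commute)
  show "1 * a = a"
    by transfer (auto simp: mod_simps fun_eq_iff)
  show "(a + b) * c = a * c + b * c"
    by transfer (simp add: mod_simps distrib_right)
  show "a + b + c = a + (b + c)"
    by transfer (simp add: mod_simps add.assoc)
  show "a + b = b + a"
    by transfer (simp add: add.commute)
  show "0 + a = a"
    by transfer (auto simp: fun_eq_iff)
  show "- a + a = 0"
    by transfer (simp add: mod_simps)
  show "a - b = a + - b"
    by transfer (simp add: mod_simps)
  have "1 < int CARD('a)"
    using prime_card_int[where 'a='a] prime_gt_1_int by blast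
  then have "(1::int) mod int CARD('a) ^ 1 = 1"
    by simp
  then show "(0::'a padic_int) \<noteq> 1"
    by transfer (metis zero_neq_one)
qed

end

lemma padic_residue_bounds:
  "0 \<le> padic_residue x n" "padic_residue (x::'p::prime_card padic_int) n < int CARD('p) ^ n"
  using padic_residue[of x] by auto

lemma padic_residue_mod:
  fixes x :: "'p::prime_card padic_int"
  assumes "m \<le> n"
  shows "padic_residue x n mod int CARD('p) ^ m = padic_residue x m"
  using assms
proof (induction n rule: dec_induct)
  case base
  then show ?case using padic_residue_bounds[of x m] by simp
next
  case (step n)
  have "padic_residue x (Suc n) mod int CARD('p) ^ n = padic_residue x n"
    using padic_residue[of x] by auto
  then show ?case
    using step by (metis le_imp_power_dvd mod_mod_cancel)
qed

lemma padic_residue_eq_0_iff: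
  fixes x :: "'p::prime_card padic_int"
  assumes "m \<le> n"
  shows "padic_residue x m = 0 \<longleftrightarrow> int CARD('p) ^ m dvd padic_residue x n"
  using padic_residue_mod[OF assms, of x] by (metis dvd_eq_mod_eq_0)

lemma padic_int_eq_0_iff: "x = 0 \<longleftrightarrow> (\<forall>n. padic_residue x n = 0)"
  by transfer auto

instance padic_int :: (prime_card) idom
proof
  fix a b :: "'a padic_int"
  let ?p = "int CARD('a)"
  assume "a \<noteq> 0" "b \<noteq> 0"
  then obtain m n where mn: "padic_residue a m \<noteq> 0" "padic_residue b n \<noteq> 0"
    by (auto simp: padic_int_eq_0_iff)
  let ?x = "padic_residue a (m + n)" and ?y = "padic_residue b (m + n)"
  have nd: "\<not> ?p ^ m dvd ?x" "\<not> ?p ^ n dvd ?y"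
    using mn padic_residue_eq_0_iff[of m "m + n" a] padic_residue_eq_0_iff[of n "m + n" b] by auto
  have p: "prime ?p" by (rule prime_card_int)
  have nz: "?x \<noteq> 0" "?y \<noteq> 0" using nd by auto
  have "multiplicity ?p (?x * ?y) = multiplicity ?p ?x + multiplicity ?p ?y"
    using p nz by (simp add: prime_elem_multiplicity_mult_distrib)
  also have "\<dots> < m + n"
    using nd by (meson add_strict_mono multiplicity_dvd' not_le)
  finally have "\<not> ?p ^ (m + n) dvd ?x * ?y"
    using nz p by (subst power_dvd_iff_le_multiplicity) (auto dest: not_prime_unit)
  then have "padic_residue (a * b) (m + n) \<noteq> 0"
    by (simp add: times_padic_int.rep_eq dvd_eq_mod_eq_0)
  then show "a * b \<noteq> 0"
    by (auto simp: padic_int_eq_0_iff)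
qed

type_synonym 'p padic = "'p padic_int fract"

lemma padic_residue_of_nat:
  "padic_residue (of_nat k :: 'p::prime_card padic_int) n = int k mod int CARD('p) ^ n"
  by (induction k)
     (simp_all add: zero_padic_int.rep_eq one_padic_int.rep_eq plus_padic_int.rep_eq mod_simps)

lemma CARD_power_dvd_padic_int_iff:
  fixes x :: "'p::prime_card padic_int"
  shows "of_nat CARD('p) ^ n dvd x \<longleftrightarrow> padic_residue x n = 0"
proof
  let ?p = "int CARD('p)" and ?f = "padic_residue x"
  have pn: "padic_residue (of_nat CARD('p) ^ n :: 'p padic_int) k = ?p ^ n mod ?p ^ k" for k
    using padic_residue_of_nat[of "CARD('p) ^ n" k, where 'p='p] by simp
  {
    assume "of_nat CARD('p) ^ n dvd x"
    then obtain y where "x = of_nat CARD('p) ^ n * y" by blast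
    then show "?f n = 0" by (simp add: times_padic_int.rep_eq pn)
  next
    assume 0: "?f n = 0"
    define g where "g k = ?f (k + n) div ?p ^ n" for k
    have fg: "?f (k + n) = ?p ^ n * g k" for k
      using padic_residue_eq_0_iff[of n "k + n" x] 0 by (simp add: g_def)
    have "g k \<in> {0..<?p ^ k} \<and> g (Suc k) mod ?p ^ k = g k" for k
    proof -
      have "0 \<le> ?p ^ n * g k" "?p ^ n * g k < ?p ^ n * ?p ^ k"
        using padic_residue_bounds[of x "k + n"] fg[of k] by (simp_all add: power_add mult.commute)
      then have "0 \<le> g k" "g k < ?p ^ k"
        using zero_less_power[OF CARD_prime_pos[where 'p='p], of n]
        by (simp_all add: zero_le_mult_iff)
      moreover have "(?p ^ n * g (Suc k)) mod (?p ^ n * ?p ^ k) = ?p ^ n * g k"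
        using padic_residue_mod[of "k + n" "Suc k + n" x] fg[of k] fg[of "Suc k"]
        by (simp add: power_add mult.commute)
      then have "?p ^ n * (g (Suc k) mod ?p ^ k) = ?p ^ n * g k"
        by (simp only: mult_mod_right)
      ultimately show ?thesis by simp
    qed
    then have "padic_residue (Abs_padic_int g :: 'p padic_int) = g"
      by (intro Abs_padic_int_inverse) auto
    then have "?f k = padic_residue (of_nat CARD('p) ^ n * Abs_padic_int g :: 'p padic_int) k" for k
      using padic_residue_mod[of k "k + n" x] fg[of k]
      by (simp add: times_padic_int.rep_eq pn mod_simps)
    then have "x = of_nat CARD('p) ^ n * Abs_padic_int g"
      by (metis ext padic_residue_inject)
    then show "of_nat CARD('p) ^ n dvd x" by simp
  }
qed

lemma of_nat_CARD_padic_int_nonzero [simp]: "(of_nat CARD('p) :: 'p::prime_card padic_int) \<noteq> 0"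
proof -
  have "1 < int CARD('p)"
    using prime_card_int[where 'a='p] prime_gt_1_int by blast
  then have "int CARD('p) mod int CARD('p) ^ 2 \<noteq> 0"
    by (simp add: power2_eq_square)
  then show ?thesis
    by (metis padic_residue_of_nat padic_int_eq_0_iff)
qed

definition padic_int_val :: "'p::prime_card padic_int \<Rightarrow> nat" where
  "padic_int_val x = (GREATEST n. of_nat CARD('p) ^ n dvd x)"

lemma CARD_power_dvd_iff_le_val:
  fixes x :: "'p::prime_card padic_int"
  assumes "x \<noteq> 0"
  shows "of_nat CARD('p) ^ n dvd x \<longleftrightarrow> n \<le> padic_int_val x"
proof -
  obtain m where "padic_residue x m \<noteq> 0"
    using assms by (auto simp: padic_int_eq_0_iff)
  then have "\<not> of_nat CARD('p) ^ m dvd x"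
    by (simp add: CARD_power_dvd_padic_int_iff)
  then have bound: "k \<le> m" if "of_nat CARD('p) ^ k dvd x" for k
    using that by (meson nle_le power_le_dvd)
  have "of_nat CARD('p) ^ padic_int_val x dvd x"
    unfolding padic_int_val_def by (rule GreatestI_nat[of _ 0 m]) (auto intro: bound)
  moreover have "k \<le> padic_int_val x" if "of_nat CARD('p) ^ k dvd x" for k
    unfolding padic_int_val_def using that by (rule Greatest_le_nat) (auto intro: bound)
  ultimately show ?thesis
    by (meson power_le_dvd)
qed

lemma padic_int_val_mult:
  fixes x y :: "'p::prime_card padic_int"
  assumes "x \<noteq> 0" "y \<noteq> 0"
  shows "padic_int_val (x * y) = padic_int_val x + padic_int_val y"
proof -
  let ?p = "of_nat CARD('p) :: 'p padic_int" and ?a = "padic_int_val x" and ?b = "padic_int_val y"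
  have p: "prime (int CARD('p))" by (rule prime_card_int)
  obtain u where u: "x = ?p ^ ?a * u"
    using CARD_power_dvd_iff_le_val[OF assms(1), of ?a] by auto
  obtain w where w: "y = ?p ^ ?b * w"
    using CARD_power_dvd_iff_le_val[OF assms(2), of ?b] by auto
  have p0: "?p ^ k \<noteq> 0" for k by simp
  have "\<not> ?p ^ 1 dvd u"
    using CARD_power_dvd_iff_le_val[OF assms(1), of "Suc ?a"] u p0[of ?a]
    by (metis Suc_eq_plus1 dvd_refl mult_dvd_mono not_less_eq_eq order_refl power_add)
  moreover have "\<not> ?p ^ 1 dvd w"
    using CARD_power_dvd_iff_le_val[OF assms(2), of "Suc ?b"] w p0[of ?b]
    by (metis Suc_eq_plus1 dvd_refl mult_dvd_mono not_less_eq_eq order_refl power_add)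
  ultimately have "\<not> int CARD('p) dvd padic_residue u 1" "\<not> int CARD('p) dvd padic_residue w 1"
    using padic_residue_eq_0_iff[OF order_refl, of u 1] padic_residue_eq_0_iff[OF order_refl, of w 1]
    by (simp_all only: CARD_power_dvd_padic_int_iff) (simp_all only: power_one_right simp_thms)
  then have "\<not> int CARD('p) dvd padic_residue u 1 * padic_residue w 1"
    using p by (simp add: prime_dvd_mult_iff)
  then have "padic_residue (u * w) 1 \<noteq> 0"
    by (simp add: times_padic_int.rep_eq dvd_eq_mod_eq_0)
  then have uw: "\<not> ?p ^ 1 dvd u * w"
    by (simp only: CARD_power_dvd_padic_int_iff simp_thms)
  have "x * y = (?p ^ ?a * u) * (?p ^ ?b * w)"
    using u w by (rule arg_cong2)
  also have "\<dots> = ?p ^ (?a + ?b) * (u * w)"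
    by (simp add: power_add mult_ac)
  finally have xy: "x * y = ?p ^ (?a + ?b) * (u * w)" .
  have "\<not> ?p ^ (?a + ?b) * ?p ^ 1 dvd ?p ^ (?a + ?b) * (u * w)"
    using uw p0[of "?a + ?b"] by (simp only: dvd_mult_cancel_left simp_thms)
  then have "\<not> ?p ^ (?a + ?b + 1) dvd x * y"
    by (simp only: xy power_add simp_thms)
  moreover have "?p ^ (?a + ?b) dvd x * y"
    by (simp only: xy dvd_triv_left)
  moreover have "x * y \<noteq> 0" using assms by simp
  ultimately have "\<not> ?a + ?b + 1 \<le> padic_int_val (x * y)" "?a + ?b \<le> padic_int_val (x * y)"
    by (simp_all only: CARD_power_dvd_iff_le_val simp_thms)
  then show ?thesis by linarith
qed

text \<open>
  The \<open>p\<close>-adic valuation takes values in \<open>\<int> \<union> {\<infinity>}\<close>, with \<open>v(a/b) = v(a) - v(b)\<close> and \<open>v(0) = \<infinity>\<close>;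
  the value \<open>-\<infinity>\<close> of the codomain is never attained.
\<close>

definition padic_val :: "'p::prime_card padic \<Rightarrow> int extended" where
  "padic_val x = (if x = 0 then \<infinity> else
     Fin (THE k. \<exists>a b. a \<noteq> 0 \<and> b \<noteq> 0 \<and> x = Fract a b \<and>
       k = int (padic_int_val a) - int (padic_int_val b)))"

lemma padic_val_0 [simp]: "padic_val 0 = \<infinity>"
  by (simp add: padic_val_def)

lemma padic_val_Fract:
  fixes a b :: "'p::prime_card padic_int"
  assumes "a \<noteq> 0" "b \<noteq> 0"
  shows "padic_val (Fract a b) = Fin (int (padic_int_val a) - int (padic_int_val b))"
proof -
  have "(THE k. \<exists>c d. c \<noteq> 0 \<and> d \<noteq> 0 \<and> Fract a b = Fract c d \<and>
      k = int (padic_int_val c) - int (padic_int_val d))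
    = int (padic_int_val a) - int (padic_int_val b)"
  proof (rule the_equality)
    fix k
    assume "\<exists>c d. c \<noteq> 0 \<and> d \<noteq> 0 \<and> Fract a b = Fract c d \<and>
      k = int (padic_int_val c) - int (padic_int_val d)"
    then obtain c d where cd: "c \<noteq> 0" "d \<noteq> 0" "Fract a b = Fract c d"
      and k: "k = int (padic_int_val c) - int (padic_int_val d)" by blast
    then have "a * d = c * b" using assms by (simp add: eq_fract)
    then have "padic_int_val a + padic_int_val d = padic_int_val c + padic_int_val b"
      using assms cd by (metis padic_int_val_mult)
    then show "k = int (padic_int_val a) - int (padic_int_val b)"
      using k by linarith
  qed (use assms in blast)
  moreover have "Fract a b \<noteq> 0"
    using assms by (simp add: Zero_fract_def eq_fract)
  ultimately show ?thesis by (simp add: padic_val_def)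
qed

lemma padic_val_CARD: "padic_val (of_nat CARD('p) :: 'p::prime_card padic) = 1"
proof -
  let ?p = "of_nat CARD('p) :: 'p padic_int"
  have gt1: "1 < int CARD('p)"
    using prime_card_int[where 'a='p] prime_gt_1_int by blast
  then have "int CARD('p) mod int CARD('p) ^ 2 \<noteq> 0"
    by (simp add: power2_eq_square)
  then have "\<not> ?p ^ 2 dvd ?p"
    by (simp only: CARD_power_dvd_padic_int_iff padic_residue_of_nat simp_thms)
  moreover have "?p ^ 1 dvd ?p" by simp
  ultimately have "\<not> 2 \<le> padic_int_val ?p" "1 \<le> padic_int_val ?p"
    by (simp_all only: CARD_power_dvd_iff_le_val of_nat_CARD_padic_int_nonzero simp_thms)
  then have p: "padic_int_val ?p = 1" by linarith
  have "\<not> ?p ^ 1 dvd 1"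
    using gt1 by (simp only: CARD_power_dvd_padic_int_iff one_padic_int.rep_eq) simp
  then have "\<not> 1 \<le> padic_int_val (1 :: 'p padic_int)"
    by (simp only: CARD_power_dvd_iff_le_val one_neq_zero simp_thms)
  then have "padic_int_val (1 :: 'p padic_int) = 0" by linarith
  with p show ?thesis
    by (simp add: of_nat_fract padic_val_Fract one_extended_def)
qed

lemma padic_val_mult:
  fixes x y :: "'p::prime_card padic"
  shows "padic_val (x * y) = padic_val x + padic_val y"
proof (cases "x = 0 \<or> y = 0")
  case True
  moreover have "padic_val z \<noteq> -\<infinity>" for z :: "'p padic"
    by (simp add: padic_val_def)
  ultimately show ?thesis
    by (cases "padic_val x"; cases "padic_val y") auto
next
  case False
  then obtain a b c d where "x = Fract a b" "a \<noteq> 0" "b \<noteq> 0" "y = Fract c d" "c \<noteq> 0" "d \<noteq> 0"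
    by (metis Fract_cases_nonzero)
  then show ?thesis
    by (simp add: padic_val_Fract padic_int_val_mult)
qed

lemma padic_val_add:
  fixes x y :: "'p::prime_card padic"
  shows "min (padic_val x) (padic_val y) \<le> padic_val (x + y)"
proof (cases "x = 0 \<or> y = 0 \<or> x + y = 0")
  case True
  then show ?thesis by (auto simp: min_def)
next
  case False
  then obtain a b c d where x: "x = Fract a b" "a \<noteq> 0" "b \<noteq> 0" and y: "y = Fract c d" "c \<noteq> 0" "d \<noteq> 0"
    by (metis Fract_cases_nonzero)
  then have xy: "x + y = Fract (a * d + c * b) (b * d)" by simp
  then have nz: "a * d + c * b \<noteq> 0"
    using False by (auto simp: eq_fract Zero_fract_def)
  let ?m = "min (padic_int_val (a * d)) (padic_int_val (c * b))"
  have "of_nat CARD('p) ^ ?m dvd a * d + c * b"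
    using x y by (intro dvd_add) (simp_all add: CARD_power_dvd_iff_le_val del: mult_eq_0_iff)
  then have "?m \<le> padic_int_val (a * d + c * b)"
    using nz by (simp add: CARD_power_dvd_iff_le_val)
  then show ?thesis
    using x y nz unfolding xy by (auto simp: padic_val_Fract padic_int_val_mult min_def split: if_splits)
qed

end

theory Submission
  imports Defs
begin

text \<open>
  Each of the two conditions forces \<open>v(B\<^sub>n) = v(b\<^sub>n B\<^sub>n\<^sub>-\<^sub>1)\<close> for all \<open>n \<ge> 1\<close>: in the recurrence
  \<open>B\<^sub>n\<^sub>+\<^sub>1 = b\<^sub>n\<^sub>+\<^sub>1 B\<^sub>n + B\<^sub>n\<^sub>-\<^sub>1\<close> the first summand has strictly smaller valuation, so it determines the
  valuation of the sum. Given this equality at \<open>n\<close>, the inequality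
  \<open>v(b\<^sub>n\<^sub>+\<^sub>1 B\<^sub>n) < v(B\<^sub>n\<^sub>-\<^sub>1)\<close> reads \<open>v(b\<^sub>n\<^sub>+\<^sub>1 b\<^sub>n B\<^sub>n\<^sub>-\<^sub>1) < v(B\<^sub>n\<^sub>-\<^sub>1)\<close>, which says that
  \<open>v(b\<^sub>n b\<^sub>n\<^sub>+\<^sub>1) < 0\<close> and \<open>B\<^sub>n\<^sub>-\<^sub>1 \<noteq> 0\<close>.
\<close>

lemma padic_val_nonzero_Fin:
  fixes x :: "'p::prime_card padic"
  assumes "x \<noteq> 0"
  obtains k where "padic_val x = Fin k"
  using assms by (simp add: padic_val_def)

text \<open>Multiplicativity gives v(1) = 2 v(1), so v(1) = 0; then (-1)(-1) = 1 gives 2 v(-1) =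
  0.\<close>

lemma padic_val_minus:
  fixes x :: "'p::prime_card padic"
  shows "padic_val (- x) = padic_val x"
proof -
  obtain k where k: "padic_val (1 :: 'p padic) = Fin k"
    by (rule padic_val_nonzero_Fin[of 1]) auto
  obtain l where l: "padic_val (- 1 :: 'p padic) = Fin l"
    by (rule padic_val_nonzero_Fin[of "- 1"]) auto
  have "k = 0"
    using padic_val_mult[of "1 :: 'p padic" 1] k by simp
  then have "l = 0"
    using padic_val_mult[of "- 1 :: 'p padic" "- 1"] k l by simp
  then have "padic_val (- 1 :: 'p padic) = 0"
    using l by (simp add: zero_extended_def)
  then show ?thesis
    using padic_val_mult[of "- 1" x] by simp
qed

text \<open>For the upper bound, apply the ultrametric inequality to
  \<open>x = (x + y) + (- y)\<close>: the minimum is at most v(x), and v(y) is too large to account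
  for this.\<close>

lemma padic_val_add_eq:
  fixes x y :: "'p::prime_card padic"
  assumes "padic_val x < padic_val y"
  shows "padic_val (x + y) = padic_val x"
proof (rule antisym)
  have "min (padic_val (x + y)) (padic_val y) \<le> padic_val x"
    using padic_val_add[of "x + y" "- y"] by (simp add: padic_val_minus)
  then show "padic_val (x + y) \<le> padic_val x"
    using assms by (auto simp: min_le_iff_disj)
  show "padic_val x \<le> padic_val (x + y)"
    using padic_val_add[of x y] assms by (simp add: min_absorb1 less_imp_le)
qed

text \<open>A finite v(y) cancels; if \<open>y = 0\<close>, both sides of the inequality are
  infinite and it fails.\<close>

lemma padic_val_mult_less_iff:
  fixes x y :: "'p::prime_card padic"
  shows "padic_val (x * y) < padic_val y \<longleftrightarrow> padic_val x < 0 \<and> y \<noteq> 0"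
proof (cases "x = 0 \<or> y = 0")
  case True
  then show ?thesis by (auto simp: zero_extended_def)
next
  case False
  then obtain k l where "padic_val x = Fin k" "padic_val y = Fin l"
    by (metis padic_val_nonzero_Fin)
  then show ?thesis
    using False by (simp add: padic_val_mult zero_extended_def)
qed

theorem theorem3p4:
  fixes b B :: "nat \<Rightarrow> 'p::prime_card padic"
  assumes "odd CARD('p)"
    and "B 0 = 1"
    and "B 1 = b 1"
    and "\<And>n. n \<ge> 2 \<Longrightarrow> B n = b n * B (n - 1) + B (n - 2)"
  shows "(\<forall>n\<ge>1. padic_val (b (n + 1) * B n) < padic_val (B (n - 1)))
     \<longleftrightarrow> (\<forall>n\<ge>1. padic_val (b n * b (n + 1)) < 0)"
proof -
  have val_B1: "padic_val (B 1) = padic_val (b 1 * B 0)"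
    using assms(2,3) by simp
  have dominant: "padic_val (B (n + 1)) = padic_val (b (n + 1) * B n)"
    if "n \<ge> 1" "padic_val (b (n + 1) * B n) < padic_val (B (n - 1))" for n
    using assms(4)[of "n + 1"] padic_val_add_eq[OF that(2)] that(1) by simp
  have less_iff: "padic_val (b (n + 1) * B n) < padic_val (B (n - 1)) \<longleftrightarrow>
      padic_val (b n * b (n + 1)) < 0 \<and> B (n - 1) \<noteq> 0"
    if "padic_val (B n) = padic_val (b n * B (n - 1))" for n
  proof -
    have "padic_val (b (n + 1) * B n) = padic_val ((b n * b (n + 1)) * B (n - 1))"
      using that by (metis padic_val_mult mult.assoc mult.commute)
    then show ?thesis
      by (simp only: padic_val_mult_less_iff)
  qed
  show ?thesis
  proof
    assume i: "\<forall>n\<ge>1. padic_val (b (n + 1) * B n) < padic_val (B (n - 1))"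
    have "padic_val (B n) = padic_val (b n * B (n - 1))" if "n \<ge> 1" for n
      using that
    proof (induction n rule: nat_induct_at_least)
      case base
      then show ?case using val_B1 by simp
    next
      case (Suc n)
      then show ?case using dominant[of n] i by simp
    qed
    then show "\<forall>n\<ge>1. padic_val (b n * b (n + 1)) < 0"
      using i less_iff by blast
  next
    assume ii: "\<forall>n\<ge>1. padic_val (b n * b (n + 1)) < 0"
    have b_nonzero: "b n \<noteq> 0" if "n \<ge> 1" for n
      using ii that by (force simp: zero_extended_def)
    \<comment> \<open>Nonvanishing of \<open>B (n - 1)\<close> joins the induction because
      \<open>less_iff\<close> needs it to yield (i).\<close>
    have "padic_val (B n) = padic_val (b n * B (n - 1)) \<and> B (n - 1) \<noteq> 0" if "n \<ge> 1" for n
      using that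
    proof (induction n rule: nat_induct_at_least)
      case base
      then show ?case using val_B1 assms(2) by simp
    next
      case (Suc n)
      then have "padic_val (b (n + 1) * B n) < padic_val (B (n - 1))"
        using less_iff ii by blast
      then have "padic_val (B (n + 1)) = padic_val (b (n + 1) * B n)"
        using dominant Suc.hyps by blast
      moreover have "b n * B (n - 1) \<noteq> 0"
        using Suc b_nonzero by simp
      \<comment> \<open>\<open>B n\<close> has the valuation of a nonzero product, which is
        finite.\<close>
      then have "B n \<noteq> 0"
        using Suc.IH by (metis extended.distinct(1) padic_val_0 padic_val_nonzero_Fin)
      ultimately show ?case by simp
    qed
    then show "\<forall>n\<ge>1. padic_val (b (n + 1) * B n) < padic_val (B (n - 1))"
      using ii less_iff by blast
  qed
qed

end
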